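(* Let $f(z)=\sum_{k=0}^\infty d_k z^k$, with $d_k\in\mathbb{C}\setminus\{0\}$ for all $k\ge 0$ and $d_0=1$, be a power series with non-zero radius of convergence $\rho$, $0<\rho\le+\infty$. Let $f_n(z)=\sum_{k=0}^n d_k z^k$ be its $n$-th partial sum, and let $$R_{2n}(z)=\frac{f_{2n}(z)}{z^n},\qquad R_{2n+1}(z)=\frac{f_{2n+1}(z)}{z^{n+1}},\qquad n=0,1,2,\dots$$ Then the following relations hold: $$\frac{1}{1-t}\,f(xt)=\sum_{n=0}^\infty f_n(x)\,t^n\qquad\text{for all } t,x\in\mathbb{C} \text{ with } |t|<1,\ |x|<\rho;$$ and $$\left(\frac{\sqrt{x}+1}{\sqrt{x}-z}\right)f(\sqrt{x}\,z)+\left(\frac{\sqrt{x}-1}{\sqrt{x}+z}\right)f(-\sqrt{x}\,z)=2\sum_{n=0}^\infty R_n(x)\,z^n$$ for all $x,z\in\mathbb{C}$ with $0<|x|<\rho$, $|z|<|\sqrt{x}|$. Here $\sqrt{x}$ denotes an arbitrarily chosen and fixed value of the square root for each $x$ (the chosen values need not form an analytic branch).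
   Context: For $|w|<\rho$, $f(w)$ denotes the sum of the convergent power series. *)

theory Defs
  imports "HOL-Analysis.Analysis"
begin

definition pseries :: "(nat \<Rightarrow> complex) \<Rightarrow> complex \<Rightarrow> complex" where
  "pseries d w = (\<Sum>k. d k * w ^ k)"

definition psum :: "(nat \<Rightarrow> complex) \<Rightarrow> nat \<Rightarrow> complex \<Rightarrow> complex" where
  "psum d n z = (\<Sum>k=0..n. d k * z ^ k)"

definition R :: "(nat \<Rightarrow> complex) \<Rightarrow> nat \<Rightarrow> complex \<Rightarrow> complex" where
  "R d m z = (if even m then psum d m z / z ^ (m div 2) else psum d m z / z ^ (m div 2 + 1))"

lemma R_even: "R d (2 * n) z = psum d (2 * n) z / z ^ n"
  by (simp add: R_def)

lemma R_odd: "R d (2 * n + 1) z = psum d (2 * n + 1) z / z ^ (n + 1)"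
  by (simp add: R_def)

end

theory Submission
  imports Defs
begin

text \<open>
  Dividing a power series by $1 - t$ replaces its coefficients by their partial sums. Applied to
  $t \mapsto f(xt)$, whose partial sums at $t = 1$ are the $f_n(x)$, this is the first relation,
  and it is valid for $|t| < 1$ because there both factors of the Cauchy product converge
  absolutely (lemma \<open>psum_generating_function\<close>).

  For the second relation fix a square root $s$ of $x$ and put $t = z/s$, so that $|t| < 1$ and
  $xt = sz$. Rewriting powers of $x$ as even powers of $s$ gives
  \[ R_n(x) z^n = f_n(x) t^n \ \mbox{for even } n, \qquad
     R_n(x) z^n = \frac{1}{s} f_n(x) t^n \ \mbox{for odd } n. \]
  Thus $\sum_n R_n(x) z^n$ is the even part of $F(t) = \sum_n f_n(x) t^n$ plus $1/s$ times its odd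
  part, that is,
  \[ 2 \sum_n R_n(x) z^n = (1 + 1/s) F(t) + (1 - 1/s) F(-t). \]
  The first relation evaluates $F(t)$ and $F(-t)$. Everything happens at a single point $x$, which
  is why the choice of square roots at different points need not be coherent.
\<close>

lemma psum_generating_function:
  fixes d :: "nat \<Rightarrow> complex"
  assumes t: "norm t < 1" and x: "ereal (norm x) < conv_radius d"
  shows "(\<lambda>n. psum d n x * t ^ n) sums (1 / (1 - t) * pseries d (x * t))"
proof -
  have "norm (x * t) \<le> norm x"
    using t by (simp add: norm_mult mult_left_le)
  then have "ereal (norm (x * t)) < conv_radius d"
    using x by (meson ereal_less_eq(3) le_less_trans)
  then have "summable (\<lambda>k. norm (d k * (x * t) ^ k))"
    by (rule abs_summable_in_conv_radius)
  moreover have "summable (\<lambda>j. norm (t ^ j))"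
    using t by (simp add: norm_power summable_geometric)
  ultimately have "(\<lambda>n. \<Sum>i\<le>n. d i * (x * t) ^ i * t ^ (n - i)) sums
      ((\<Sum>k. d k * (x * t) ^ k) * (\<Sum>j. t ^ j))"
    by (rule Cauchy_product_sums)
  moreover have "(\<Sum>i\<le>n. d i * (x * t) ^ i * t ^ (n - i)) = psum d n x * t ^ n" for n
    unfolding psum_def atLeast0AtMost sum_distrib_right
  proof (rule sum.cong[OF refl])
    fix i assume "i \<in> {..n}"
    then have "t ^ n = t ^ i * t ^ (n - i)"
      by (simp flip: power_add)
    then show "d i * (x * t) ^ i * t ^ (n - i) = d i * x ^ i * t ^ n"
      by (simp add: power_mult_distrib)
  qed
  moreover have "(\<Sum>j. t ^ j) = 1 / (1 - t)"
    using t by (rule suminf_geometric)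
  ultimately show ?thesis
    by (simp add: pseries_def mult.commute)
qed

text \<open>
  The coefficients $1 + 1/s$ and $1 - 1/s$ are chosen so that $t^n$ and $(-t)^n$ combine to $2t^n$
  for even $n$ and to $2t^n/s$ for odd $n$. The extra factor $1/s$ comes from the denominator of
  $R_{2m+1}$, which is $x^{m+1} = s^{2m+2}$, one power of $s$ more than $z^{2m+1} = (st)^{2m+1}$
  supplies.
\<close>

lemma R_term_even_odd_split:
  fixes s z :: complex
  assumes "s \<noteq> 0"
  shows "2 * (R d n (s\<^sup>2) * z ^ n) =
    (1 + 1 / s) * (psum d n (s\<^sup>2) * (z / s) ^ n) + (1 - 1 / s) * (psum d n (s\<^sup>2) * (- (z / s)) ^ n)"
proof (cases "even n")
  case True
  then obtain m where n: "n = 2 * m" by blast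
  have "(s\<^sup>2) ^ m = s ^ n" by (simp add: n power_mult)
  with True have "R d n (s\<^sup>2) * z ^ n = psum d n (s\<^sup>2) * (z / s) ^ n"
    by (simp add: R_def n power_divide)
  with True show ?thesis by (simp add: algebra_simps)
next
  case False
  then obtain m where n: "n = 2 * m + 1" by (elim oddE)
  have "(s\<^sup>2) ^ (m + 1) = s * s ^ n" by (simp add: n power_mult power2_eq_square)
  with False have "R d n (s\<^sup>2) * z ^ n = psum d n (s\<^sup>2) * (z / s) ^ n / s"
    by (simp add: R_def n power_divide mult_ac)
  with False show ?thesis by (simp add: algebra_simps)
qed

lemma R_generating_function:
  fixes d :: "nat \<Rightarrow> complex" and s z :: complex
  assumes x: "ereal (norm (s\<^sup>2)) < conv_radius d" and z: "norm z < norm s"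
  shows "(\<lambda>n. 2 * (R d n (s\<^sup>2) * z ^ n)) sums
    ((s + 1) / (s - z) * pseries d (s * z) + (s - 1) / (s + z) * pseries d (- s * z))"
proof -
  have s: "s \<noteq> 0" using z by auto
  have nz: "s - z \<noteq> 0" "s + z \<noteq> 0"
    using z by (auto simp: add_eq_0_iff)
  have t: "norm (z / s) < 1" "norm (- (z / s)) < 1"
    using z s by (simp_all add: norm_divide)
  have arg: "s\<^sup>2 * (z / s) = s * z" "s\<^sup>2 * - (z / s) = - s * z"
    using s by (simp_all add: power2_eq_square)
  have coeff: "(1 + 1 / s) * (1 / (1 - z / s)) = (s + 1) / (s - z)"
    "(1 - 1 / s) * (1 / (1 - - (z / s))) = (s - 1) / (s + z)"
    using s nz by (simp_all add: divide_simps)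
  have "(\<lambda>n. 2 * (R d n (s\<^sup>2) * z ^ n)) sums
    ((1 + 1 / s) * (1 / (1 - z / s) * pseries d (s\<^sup>2 * (z / s))) +
     (1 - 1 / s) * (1 / (1 - - (z / s)) * pseries d (s\<^sup>2 * - (z / s))))"
    unfolding R_term_even_odd_split[OF s]
    by (intro sums_add sums_mult psum_generating_function t x)
  then show ?thesis
    unfolding arg mult.assoc[symmetric] coeff .
qed

theorem theorem1:
  fixes d :: "nat \<Rightarrow> complex" and \<rho> :: ereal and sq :: "complex \<Rightarrow> complex"
  assumes d_nonzero: "\<And>k. d k \<noteq> 0"
    and d_0: "d 0 = 1"
    and radius: "\<rho> = conv_radius d"
    and radius_pos: "0 < \<rho>"
    and sq: "\<And>x. 0 < norm x \<Longrightarrow> ereal (norm x) < \<rho> \<Longrightarrow> (sq x)\<^sup>2 = x"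
  shows "(\<forall>t x :: complex. norm t < 1 \<longrightarrow> ereal (norm x) < \<rho> \<longrightarrow>
            summable (\<lambda>n. psum d n x * t ^ n) \<and>
            1 / (1 - t) * pseries d (x * t) = (\<Sum>n. psum d n x * t ^ n)) \<and>
         (\<forall>x z :: complex. 0 < norm x \<longrightarrow> ereal (norm x) < \<rho> \<longrightarrow> norm z < norm (sq x) \<longrightarrow>
            summable (\<lambda>n. R d n x * z ^ n) \<and>
            (sq x + 1) / (sq x - z) * pseries d (sq x * z)
              + (sq x - 1) / (sq x + z) * pseries d (- sq x * z)
            = 2 * (\<Sum>n. R d n x * z ^ n))"
proof (intro conjI allI impI)
  fix t x :: complex
  assume "norm t < 1" "ereal (norm x) < \<rho>"
  then have "(\<lambda>n. psum d n x * t ^ n) sums (1 / (1 - t) * pseries d (x * t))"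
    using psum_generating_function radius by simp
  then show "summable (\<lambda>n. psum d n x * t ^ n)"
    and "1 / (1 - t) * pseries d (x * t) = (\<Sum>n. psum d n x * t ^ n)"
    by (simp_all add: sums_iff)
next
  fix x z :: complex
  assume x: "0 < norm x" "ereal (norm x) < \<rho>" and z: "norm z < norm (sq x)"
  have "(\<lambda>n. 2 * (R d n x * z ^ n)) sums
      ((sq x + 1) / (sq x - z) * pseries d (sq x * z)
        + (sq x - 1) / (sq x + z) * pseries d (- sq x * z))"
    using R_generating_function[of "sq x" d z] sq[OF x] x z radius by simp
  then have sum: "(\<lambda>n. R d n x * z ^ n) sums
      (((sq x + 1) / (sq x - z) * pseries d (sq x * z)
        + (sq x - 1) / (sq x + z) * pseries d (- sq x * z)) / 2)"
    using sums_divide[where c = 2] by fastforce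
  then show "summable (\<lambda>n. R d n x * z ^ n)"
    by (rule sums_summable)
  show "(sq x + 1) / (sq x - z) * pseries d (sq x * z)
      + (sq x - 1) / (sq x + z) * pseries d (- sq x * z)
    = 2 * (\<Sum>n. R d n x * z ^ n)"
    unfolding sums_unique[OF sum, symmetric]
    by (simp only: times_divide_eq_right nonzero_mult_div_cancel_left zero_neq_numeral[symmetric] not_False_eq_True)
qed

end
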